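(* Let $G$ be a permutation group with a cyclic regular normal subgroup $W$ and a cyclic point stabilizer $A$. For a subgroup $H$ of $G$, the following hold: (1) $H$ is relatively closed in $G$ if and only if $\operatorname{rad}(H)=H\cap W$ and $C_A(W/(H\cap W))\leqslant H$. (2) The relative closure of $H$ in $G$ is the product of $H$, $\operatorname{rad}(H)$, and $C_A(W/\operatorname{rad}(H))$.
   Context: All groups are finite. Since $W$ is a regular normal subgroup and $A$ a point stabilizer, $G=A\ltimes W$ is a semidirect product, and $G$ is regarded as a permutation group on the set $W$ via $u^{bv}=u^bv$ for $u,v\in W$, $b\in A$ (where $u^b=b^{-1}ub$; $A$ is the stabilizer of $1\in W$ and acts faithfully on $W$ by automorphisms). $\operatorname{Orb}(H,W)$ is the set of orbits of $H\leqslant G$ on $W$. For $\Omega\in\operatorname{Orb}(H,W)$ put $\operatorname{rad}(\Omega)=\{w\in W : \Omega^w=\Omega\}$, and $\operatorname{rad}(H)=\bigcap_{\Omega\in\operatorname{Orb}(H,W)}\operatorname{rad}(\Omega)$; equivalently, $\operatorname{rad}(H)$ is the largest subgroup of $W$ such that every orbit of $H$ is a union of its cosets. The relative closure of $H$ in $G$ is the largest subgroup $K$ of $G$ with $\operatorname{Orb}(K,W)=\operatorname{Orb}(H,W)$; $H$ is relatively closed in $G$ if it coincides with its relative closure in $G$. For $N\leqslant W$ (every such $N$ is characteristic in $W$), $C_A(W/N)$ is the subgroup of elements of $A$ acting trivially on $W/N$. *)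

theory Defs
  imports "HOL-Algebra.Algebra"
begin

text \<open>
  A permutation group is rendered as a faithful action \<open>\<phi>\<close> of a group \<open>G\<close> on a set \<open>S\<close>.  Library
  actions are left actions, whereas the actions on \<open>W\<close> below are right actions; the right action on
  \<open>S\<close> belonging to \<open>\<phi>\<close> is \<open>x\<^sup>g = \<phi> (g\<inverse>) x\<close>, and transitivity, regularity and point stabilizers are
  the same for both.
\<close>

definition regular_on :: "('g, 'm) monoid_scheme \<Rightarrow> 'x set \<Rightarrow> ('g \<Rightarrow> 'x \<Rightarrow> 'x) \<Rightarrow> 'g set \<Rightarrow> bool"
  where "regular_on G S \<phi> W \<longleftrightarrow>
    transitive_action (G\<lparr>carrier := W\<rparr>) S \<phi> \<and>
    (\<forall>x\<in>S. stabilizer (G\<lparr>carrier := W\<rparr>) \<phi> x = {\<one>\<^bsub>G\<^esub>})"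

definition conj_by :: "('g, 'm) monoid_scheme \<Rightarrow> 'g \<Rightarrow> 'g \<Rightarrow> 'g"
  where "conj_by G b u = inv\<^bsub>G\<^esub> b \<otimes>\<^bsub>G\<^esub> u \<otimes>\<^bsub>G\<^esub> b"

text \<open>
  The right action of \<open>G = A W\<close> on \<open>W\<close>: an element \<open>g = b v\<close> with \<open>b \<in> A\<close>, \<open>v \<in> W\<close> maps \<open>u\<close> to
  \<open>u\<^sup>b v\<close>.  The description is definite when \<open>A\<close> and \<open>W\<close> are complements in \<open>G\<close>; see
  \<open>actW_mult\<close> and \<open>actW_transport\<close> below.
\<close>

definition actW :: "('g, 'm) monoid_scheme \<Rightarrow> 'g set \<Rightarrow> 'g set \<Rightarrow> 'g \<Rightarrow> 'g \<Rightarrow> 'g"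
  where "actW G A W g u =
    (THE y. \<exists>b\<in>A. \<exists>v\<in>W. g = b \<otimes>\<^bsub>G\<^esub> v \<and> y = conj_by G b u \<otimes>\<^bsub>G\<^esub> v)"

definition Orb :: "('g, 'm) monoid_scheme \<Rightarrow> 'g set \<Rightarrow> 'g set \<Rightarrow> 'g set \<Rightarrow> 'g set set"
  where "Orb G A W H = orbits (G\<lparr>carrier := H\<rparr>) W (actW G A W)"

definition rad_set :: "('g, 'm) monoid_scheme \<Rightarrow> 'g set \<Rightarrow> 'g set \<Rightarrow> 'g set \<Rightarrow> 'g set"
  where "rad_set G A W \<Omega> = {w \<in> W. actW G A W w ` \<Omega> = \<Omega>}"

definition rad :: "('g, 'm) monoid_scheme \<Rightarrow> 'g set \<Rightarrow> 'g set \<Rightarrow> 'g set \<Rightarrow> 'g set"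
  where "rad G A W H = (\<Inter>\<Omega>\<in>Orb G A W H. rad_set G A W \<Omega>)"

text \<open>\<open>K\<close> is the relative closure of \<open>H\<close> in \<open>G\<close>; by antisymmetry there is at most one such \<open>K\<close>.\<close>

definition is_relative_closure ::
    "('g, 'm) monoid_scheme \<Rightarrow> 'g set \<Rightarrow> 'g set \<Rightarrow> 'g set \<Rightarrow> 'g set \<Rightarrow> bool"
  where "is_relative_closure G A W H K \<longleftrightarrow>
    subgroup K G \<and> Orb G A W K = Orb G A W H \<and>
    (\<forall>L. subgroup L G \<and> Orb G A W L = Orb G A W H \<longrightarrow> L \<subseteq> K)"

definition relatively_closed :: "('g, 'm) monoid_scheme \<Rightarrow> 'g set \<Rightarrow> 'g set \<Rightarrow> 'g set \<Rightarrow> bool"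
  where "relatively_closed G A W H \<longleftrightarrow> is_relative_closure G A W H H"

text \<open>\<open>C\<^sub>A(W/N)\<close>: an element of \<open>A\<close> acts on the cosets of \<open>N\<close> in \<open>W\<close> by conjugation.\<close>

definition cent_quot :: "('g, 'm) monoid_scheme \<Rightarrow> 'g set \<Rightarrow> 'g set \<Rightarrow> 'g set \<Rightarrow> 'g set"
  where "cent_quot G A W N =
    {b \<in> A. \<forall>C \<in> carrier (G\<lparr>carrier := W\<rparr> Mod N). conj_by G b ` C = C}"

lemma (in group) actW_mult:
  assumes "subgroup A G" "subgroup W G" "A \<inter> W = {\<one>}" "b \<in> A" "v \<in> W"
  shows "actW G A W (b \<otimes> v) u = conj_by G b u \<otimes> v"
proof -
  have "b' = b \<and> v' = v" if "b' \<in> A" "v' \<in> W" "b \<otimes> v = b' \<otimes> v'" for b' v'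
  proof -
    have c: "b \<in> carrier G" "b' \<in> carrier G" "v \<in> carrier G" "v' \<in> carrier G"
      using assms that subgroup.mem_carrier by metis+
    have "inv b' \<otimes> b = inv b' \<otimes> (b \<otimes> v) \<otimes> inv v"
      using c by (simp add: m_assoc)
    also have "\<dots> = inv b' \<otimes> b' \<otimes> (v' \<otimes> inv v)"
      unfolding that(3) using c by (simp only: m_assoc inv_closed m_closed)
    also have "\<dots> = v' \<otimes> inv v"
      using c by (metis l_inv l_one inv_closed m_closed)
    finally have e: "inv b' \<otimes> b = v' \<otimes> inv v" .
    have "inv b' \<otimes> b \<in> A" "v' \<otimes> inv v \<in> W"
      using assms that by (simp_all add: subgroup.m_closed subgroup.m_inv_closed)
    with e assms(3) have "inv b' \<otimes> b = \<one>" "v' \<otimes> inv v = \<one>"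
      by auto
    then show ?thesis
      using c by (metis inv_equality inv_inv inv_closed)
  qed
  then show ?thesis
    unfolding actW_def using assms(4,5) by (intro the_equality) blast+
qed

text \<open>Under the bijection \<open>u \<mapsto> x\<^sup>u\<close> from \<open>W\<close> to \<open>S\<close>, \<open>actW\<close> is the given action on \<open>S\<close>.\<close>

lemma (in group_action) actW_transport:
  assumes x: "x \<in> E" and W: "subgroup W G" "regular_on G E \<phi> W"
    and g: "g \<in> carrier G" and u: "u \<in> W"
  shows "\<phi> (inv (actW G (stabilizer G \<phi> x) W g u)) x = \<phi> (inv g) (\<phi> (inv u) x)"
proof -
  interpret group G
    using group_hom group_hom.axioms(1) by blast
  let ?A = "stabilizer G \<phi> x"
  have A: "subgroup ?A G"
    using x by (rule stabilizer_subgroup)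
  have int: "?A \<inter> W = {\<one>}"
    using W x subgroup.subset[OF W(1)] by (auto simp: regular_on_def stabilizer_def)
  interpret T: transitive_action "G\<lparr>carrier := W\<rparr>" E \<phi>
    using W by (simp add: regular_on_def)
  have gx: "\<phi> g x \<in> E" 
    using element_image g x by blast
  have "\<phi> (inv g) x \<in> E"
    using element_image g x by blast
  then obtain v where v: "v \<in> W" "\<phi> v (\<phi> (inv g) x) = x"
    using T.unique_orbit x by fastforce
  have vc: "v \<in> carrier G" and uc: "u \<in> carrier G"
    using v u subgroup.mem_carrier[OF W(1)] by auto
  define b where "b = g \<otimes> inv v"
  have bc: "b \<in> carrier G"
    using g vc by (simp add: b_def)
  have "\<phi> (inv b) x = x"
    using v g vc x by (simp add: b_def inv_mult_group composition_rule)
  then have bx: "\<phi> b x = x"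
    using orbit_sym_aux bc x by (metis inv_closed inv_inv)
  have bA: "b \<in> ?A"
    using bx bc by (simp add: stabilizer_def)
  have gb: "g = b \<otimes> v"
    using g vc by (simp add: b_def m_assoc)
  have act: "actW G ?A W g u = inv b \<otimes> u \<otimes> b \<otimes> v"
    unfolding gb using actW_mult[OF A W(1) int bA v(1)] by (simp add: conj_by_def)
  have "inv (inv b \<otimes> u \<otimes> b \<otimes> v) = inv g \<otimes> (inv u \<otimes> b)"
    using bc vc uc by (simp add: gb inv_mult_group m_assoc)
  then show ?thesis
    unfolding act using bx x g uc bc by (simp add: composition_rule)
qed

end

theory Submission
  imports Defs
begin

text \<open>
  Let \<open>M\<close> be the group of all elements of \<open>G\<close> stabilizing every \<open>H\<close>-orbit; it is the relative closure of
  \<open>H\<close>, and \<open>R = rad(H) = M \<inter> W\<close>.  The kernel \<open>N\<close> of \<open>G\<close> acting on \<open>W/R\<close> is \<open>R C\<^sub>A(W/R)\<close> and lies in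
  \<open>M\<close>, so it remains to prove \<open>M \<le> H N\<close>.  As \<open>M/R\<close> embeds in \<open>A\<close>, it is cyclic, say with generator \<open>g R\<close>.
  The groups \<open>M\<close> and \<open>H\<close> have the same orbits, so for each \<open>u \<in> W\<close> some \<open>g\<^sup>j \<in> H N\<close> is such that
  \<open>g\<^bsup>1-j\<^esup>\<close> fixes the coset \<open>u R\<close>.  Multiplying the exponents \<open>1 - j\<close> over all \<open>u\<close> gives \<open>g\<^bsup>1-i\<^esup> \<in> N\<close>
  with \<open>g\<^sup>i \<in> H N\<close>, whence \<open>g \<in> H N\<close>.
\<close>

section \<open>Exponents and cyclic groups\<close>

text \<open>Division with remainder: the least positive element of \<open>I\<close> leaves a
  remainder that lies in \<open>I\<close> again, hence is zero. If \<open>I = {0}\<close>, then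
  \<open>d = 0\<close>.\<close>

lemma int_subgroup_principal:
  fixes I :: "int set"
  assumes "0 \<in> I" and diff: "\<And>i j. i \<in> I \<Longrightarrow> j \<in> I \<Longrightarrow> i - j \<in> I"
  shows "\<exists>d\<in>I. \<forall>i\<in>I. d dvd i"
proof (cases "I = {0}")
  case False
  have neg: "- i \<in> I" if "i \<in> I" for i
    using diff[OF assms(1) that] by simp
  have plus: "i + j \<in> I" if "i \<in> I" "j \<in> I" for i j
    using diff[OF that(1) neg[OF that(2)]] by simp
  have natmul: "int n * i \<in> I" if "i \<in> I" for n i
    by (induction n) (use that assms(1) plus in \<open>auto simp: algebra_simps\<close>)
  have mul: "k * i \<in> I" if "i \<in> I" for k i
    by (cases k rule: int_cases2) (use natmul[OF that] neg in auto)
  obtain i where "i \<in> I" "i \<noteq> 0"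
    using False assms(1) by auto
  then have "\<exists>n::nat. n > 0 \<and> int n \<in> I"
    using neg by (intro exI[of _ "nat \<bar>i\<bar>"]) (auto simp: abs_if)
  then obtain d :: nat where d: "d > 0" "int d \<in> I"
    and least: "\<And>n. n < d \<Longrightarrow> \<not> (n > 0 \<and> int n \<in> I)"
    using exists_least_iff[of "\<lambda>n. n > 0 \<and> int n \<in> I"] by blast
  have "int d dvd i" if "i \<in> I" for i
  proof -
    have "i mod int d \<in> I"
      using diff[OF that mul[OF d(2), of "i div int d"]] by (simp add: minus_div_mult_eq_mod)
    moreover have "0 \<le> i mod int d" "i mod int d < int d"
      using d by simp_all
    ultimately have "nat (i mod int d) = 0"
      using least[of "nat (i mod int d)"] by fastforce
    with \<open>0 \<le> i mod int d\<close> show ?thesis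
      by (simp add: dvd_eq_mod_eq_0)
  qed
  with d show ?thesis
    by blast
qed auto

text \<open>To be applied with \<open>T = H <#> kern R\<close> and \<open>St u\<close> the
  stabilizer of the coset of \<open>u\<close>. The exponent \<open>j\<close> may depend on
  \<open>u\<close>; since \<open>U\<close> is finite, all of them can be merged into one
  \<open>i\<close>. Then \<open>g [^] (1 - i)\<close> lies in every \<open>St u\<close>, hence in
  \<open>T\<close>, and so does its product with \<open>g [^] i\<close>, which is
  \<open>g\<close>.\<close>

lemma (in group) mem_subgroup_of_power_conditions:
  assumes T: "subgroup T G" and g: "g \<in> carrier G" and U: "finite U"
    and St: "\<And>u. u \<in> U \<Longrightarrow> subgroup (St u) G"
    and Int: "\<And>x. x \<in> carrier G \<Longrightarrow> (\<And>u. u \<in> U \<Longrightarrow> x \<in> St u) \<Longrightarrow> x \<in> T"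
    and pow: "\<And>u. u \<in> U \<Longrightarrow> \<exists>j::int. g [^] j \<in> T \<and> g [^] (1 - j) \<in> St u"
  shows "g \<in> T"
proof -
  have powmem: "g [^] (i * k) \<in> K" if "subgroup K G" "g [^] i \<in> K" for K and i k :: int
    using subgroup_int_pow_closed[OF that] g by (simp add: int_pow_pow)
  have "\<exists>i::int. g [^] i \<in> T \<and> (\<forall>u\<in>F. g [^] (1 - i) \<in> St u)" if "finite F" "F \<subseteq> U" for F
    using that
  proof (induction F)
    case empty
    show ?case
      using subgroup.one_closed[OF T] by (intro exI[of _ 0]) simp
  next
    case (insert u F)
    then obtain i :: int where i: "g [^] i \<in> T" "\<forall>u\<in>F. g [^] (1 - i) \<in> St u"
      by auto
    obtain j :: int where j: "g [^] j \<in> T" "g [^] (1 - j) \<in> St u"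
      using pow insert by blast
    \<comment> \<open>The merged exponent is chosen so that the complementary exponents multiply,
      which preserves membership in the old and the new \<open>St\<close>. Being \<open>i\<close>
      plus a multiple of \<open>j\<close>, it also keeps the power in \<open>T\<close>.\<close>
    have eq: "1 - (i + j * (1 - i)) = (1 - i) * (1 - j)"
      by (simp add: algebra_simps)
    have "g [^] (i + j * (1 - i)) \<in> T"
      using subgroup.m_closed[OF T i(1) powmem[OF T j(1)]] g by (simp add: int_pow_mult)
    moreover have "g [^] (1 - (i + j * (1 - i))) \<in> St v" if "v \<in> insert u F" for v
    proof (cases "v = u")
      case True
      then show ?thesis
        unfolding eq using powmem[OF St j(2), of "1 - i"] insert.prems by (simp add: mult.commute)
    next
      case False
      then show ?thesis
        unfolding eq using powmem[OF St, of v "1 - i" "1 - j"] insert.prems that i(2) by auto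
    qed
    ultimately show ?case
      by blast
  qed
  from this[OF U subset_refl] obtain i :: int
    where i: "g [^] i \<in> T" "\<forall>u\<in>U. g [^] (1 - i) \<in> St u"
    by blast
  have "g [^] (1 - i) \<in> T"
    using i(2) g by (intro Int) auto
  then have "g [^] (1 - i) \<otimes> g [^] i \<in> T"
    using i(1) subgroup.m_closed[OF T] by blast
  then show ?thesis
    using g by (simp add: int_pow_mult[symmetric])
qed

text \<open>Conjugation by \<open>x\<close> sends a generator \<open>w\<close> of \<open>W\<close>
  to some \<open>w [^] t\<close>, so it acts on all of \<open>W\<close> as the \<open>t\<close>-th
  power map, and every subgroup is closed under powers.\<close>

lemma (in group) normal_subset_cyclic_normal:
  assumes W: "W \<lhd> G" and cyc: "cyclic_group (G\<lparr>carrier := W\<rparr>)"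
    and R: "subgroup R G" "R \<subseteq> W"
  shows "R \<lhd> G"
proof (rule normal_invI[OF R(1)])
  fix x r assume x: "x \<in> carrier G" and r: "r \<in> R"
  interpret W: normal W G by (rule W)
  interpret GW: group "G\<lparr>carrier := W\<rparr>"
    using W.subgroup_axioms subgroup_imp_group by blast
  obtain w where w: "w \<in> W" "W = range (\<lambda>n::int. w [^] n)"
    using cyc unfolding GW.cyclic_group
    by (auto simp: int_pow_consistent[OF W.subgroup_axioms, symmetric])
  have wc: "w \<in> carrier G" using w by auto
  have hom: "(\<lambda>y. x \<otimes> y \<otimes> inv x) \<in> hom G G"
    using x by (auto intro!: homI simp: m_assoc inv_solve_left)
  interpret c: group_hom G G "\<lambda>y. x \<otimes> y \<otimes> inv x"
    using hom by unfold_locales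
  have "x \<otimes> w \<otimes> inv x \<in> W"
    using w(1) x W.inv_op_closed2 by blast
  then obtain t :: int where t: "x \<otimes> w \<otimes> inv x = w [^] t"
    using w(2) by blast
  obtain s :: int where s: "r = w [^] s"
    using r R(2) w(2) by blast
  have "x \<otimes> r \<otimes> inv x = (w [^] t) [^] s"
    using c.hom_int_pow[OF wc, of s] t by (simp add: s)
  also have "\<dots> = r [^] t"
    using wc by (simp add: s int_pow_pow mult.commute)
  finally show "x \<otimes> r \<otimes> inv x \<in> R"
    using subgroup_int_pow_closed[OF R(1) r] by simp
qed

lemma (in group) inv_mult_cancel:
  assumes "x \<in> carrier G" "y \<in> carrier G"
  shows "inv x \<otimes> (x \<otimes> y) = y" "x \<otimes> (inv x \<otimes> y) = y"
  using assms by (simp_all add: m_assoc[symmetric])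

section \<open>The split extension and its action on \<open>W\<close>\<close>

text \<open>The setting is internal to \<open>G\<close>: the point stabilizer and the regular normal
  subgroup become complements, and \<open>actW\<close> on \<open>W\<close> takes the place of the
  action on \<open>S\<close>.\<close>

locale cyclic_split_extension = group G for G (structure) +
  fixes A W :: "'a set"
  assumes A: "subgroup A G" and W: "W \<lhd> G"
    and inter: "A \<inter> W = {\<one>}" and prod: "A <#> W = carrier G"
    and fin: "finite W"
    and cyc_A: "cyclic_group (G\<lparr>carrier := A\<rparr>)" and cyc_W: "cyclic_group (G\<lparr>carrier := W\<rparr>)"
begin

sublocale A: subgroup A G by (rule A)
sublocale W: normal W G by (rule W)

abbreviation act where "act \<equiv> actW G A W"

lemma W_sub: "subgroup W G"
  by (rule W.subgroup_axioms)

lemma W_nonempty: "W \<noteq> {}"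
  using W.one_closed by (metis empty_iff)

lemma W_comm:
  assumes "u \<in> W" "v \<in> W" shows "u \<otimes> v = v \<otimes> u"
proof -
  interpret GW: group "G\<lparr>carrier := W\<rparr>"
    using W_sub subgroup_imp_group by blast
  interpret GW: comm_group "G\<lparr>carrier := W\<rparr>"
    using GW.cyclic_imp_abelian_group[OF cyc_W] .
  show ?thesis
    using GW.m_comm assms by simp
qed

lemma split:
  assumes "g \<in> carrier G" obtains b v where "b \<in> A" "v \<in> W" "g = b \<otimes> v"
  using assms prod by (force simp: set_mult_def)

lemma act_split:
  assumes "b \<in> A" "v \<in> W" shows "act (b \<otimes> v) u = inv b \<otimes> u \<otimes> b \<otimes> v"
  using actW_mult[OF A W_sub inter assms] by (simp add: conj_by_def)

lemma act_closed [simp, intro]: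
  assumes "g \<in> carrier G" "u \<in> W" shows "act g u \<in> W"
proof -
  obtain b v where "b \<in> A" "v \<in> W" "g = b \<otimes> v"
    using split[OF assms(1)] .
  then show ?thesis
    using assms W.inv_op_closed1 by (simp add: act_split)
qed

text \<open>The action on \<open>W\<close> is the action of \<open>G\<close> by right multiplication on the right cosets of \<open>A\<close>.\<close>

lemma act_eqI:
  assumes "g \<in> carrier G" "u \<in> W" "y \<in> W" "a \<in> A" "u \<otimes> g = a \<otimes> y"
  shows "act g u = y"
proof -
  obtain b v where bv: "b \<in> A" "v \<in> W" "g = b \<otimes> v"
    using split[OF assms(1)] .
  note c = A.mem_carrier[OF bv(1)] W.mem_carrier[OF bv(2)] A.mem_carrier[OF assms(4)]
    W.mem_carrier[OF assms(2)] W.mem_carrier[OF assms(3)]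
  let ?z = "act g u"
  have z: "?z \<in> W" using assms by simp
  have "b \<otimes> ?z = u \<otimes> g"
    using c by (simp add: bv act_split m_assoc inv_mult_cancel)
  then have "inv a \<otimes> b \<otimes> ?z = y"
    using c W.mem_carrier[OF z] assms(5) by (simp add: m_assoc inv_mult_cancel)
  \<comment> \<open>The left side lies in \<open>A\<close> and the right side in \<open>W\<close>,
    so both are trivial.\<close>
  then have eq: "inv a \<otimes> b = y \<otimes> inv ?z"
    using c W.mem_carrier[OF z] by (metis inv_closed m_closed inv_solve_right)
  have "inv a \<otimes> b \<in> A" "y \<otimes> inv ?z \<in> W"
    using bv assms z by auto
  with eq inter have "y \<otimes> inv ?z = \<one>" by auto
  then show ?thesis
    using c W.mem_carrier[OF z] by (metis inv_equality inv_inv inv_closed)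
qed

lemma act_cosetE:
  assumes "g \<in> carrier G" "u \<in> W"
  obtains a where "a \<in> A" "u \<otimes> g = a \<otimes> act g u"
proof -
  obtain b v where bv: "b \<in> A" "v \<in> W" "g = b \<otimes> v"
    using split[OF assms(1)] .
  have "u \<otimes> g = b \<otimes> act g u"
    using A.mem_carrier[OF bv(1)] W.mem_carrier[OF bv(2)] W.mem_carrier[OF assms(2)]
    by (simp add: bv act_split m_assoc inv_mult_cancel)
  with bv that show ?thesis by blast
qed

text \<open>Since \<open>act g u\<close> represents the coset of \<open>A\<close> containing
  \<open>u \<otimes> g\<close>, this is associativity of multiplication in \<open>G\<close>; the two
  factors from \<open>A\<close> are collected in front.\<close>

lemma act_mult:
  assumes "g \<in> carrier G" "h \<in> carrier G" "u \<in> W"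
  shows "act (g \<otimes> h) u = act h (act g u)"
proof -
  obtain a where a: "a \<in> A" "u \<otimes> g = a \<otimes> act g u"
    using act_cosetE assms by blast
  obtain a' where a': "a' \<in> A" "act g u \<otimes> h = a' \<otimes> act h (act g u)"
    using act_cosetE[OF assms(2)] assms by blast
  note c = A.mem_carrier[OF a(1)] A.mem_carrier[OF a'(1)] W.mem_carrier[OF assms(3)]
    W.mem_carrier[OF act_closed[OF assms(1,3)]]
    W.mem_carrier[OF act_closed[OF assms(2) act_closed[OF assms(1,3)]]]
  have "u \<otimes> (g \<otimes> h) = a \<otimes> act g u \<otimes> h"
    using c assms by (simp add: m_assoc[symmetric] a(2))
  also have "\<dots> = (a \<otimes> a') \<otimes> act h (act g u)"
    using c assms a'(2) by (simp add: m_assoc)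
  finally show ?thesis
    using assms a a' by (intro act_eqI[where a = "a \<otimes> a'"]) auto
qed

lemma act_one [simp]: "u \<in> W \<Longrightarrow> act \<one> u = u"
  by (rule act_eqI[where a = \<one>]) auto

lemma act_W: "w \<in> W \<Longrightarrow> u \<in> W \<Longrightarrow> act w u = u \<otimes> w"
  by (rule act_eqI[where a = \<one>]) auto

lemma act_A: "b \<in> A \<Longrightarrow> u \<in> W \<Longrightarrow> act b u = conj_by G b u"
  using act_split[of b \<one> u] by (simp add: conj_by_def)

lemma act_inv [simp]:
  assumes "g \<in> carrier G" "u \<in> W"
  shows "act (inv g) (act g u) = u" "act g (act (inv g) u) = u"
  using assms by (simp_all add: act_mult[symmetric])

text \<open>For \<open>g = b \<otimes> v\<close> the difference of two points is conjugated by
  \<open>b\<close> and then by \<open>v\<close>. This is what makes \<open>G\<close> permute the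
  cosets of a normal subgroup.\<close>

lemma act_diff:
  assumes "g \<in> carrier G" "u \<in> W" "y \<in> W"
  shows "inv (act g u) \<otimes> act g y = inv g \<otimes> (inv u \<otimes> y) \<otimes> g"
proof -
  obtain b v where bv: "b \<in> A" "v \<in> W" "g = b \<otimes> v"
    using split[OF assms(1)] .
  show ?thesis
    using A.mem_carrier[OF bv(1)] W.mem_carrier[OF bv(2)] W.mem_carrier[OF assms(2)]
      W.mem_carrier[OF assms(3)] bv
    by (simp add: act_split inv_mult_group m_assoc inv_mult_cancel)
qed

section \<open>Setwise stabilizers and orbits\<close>

lemma subgroup_setwise_stabilizer:
  assumes "\<Omega> \<subseteq> W"
  shows "subgroup {g \<in> carrier G. act g ` \<Omega> = \<Omega>} G"
proof (rule subgroupI)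
  show "{g \<in> carrier G. act g ` \<Omega> = \<Omega>} \<noteq> {}"
    using assms by (auto intro!: exI[of _ \<one>] image_cong[THEN trans] simp: subset_iff image_iff)
next
  fix g assume g: "g \<in> {g \<in> carrier G. act g ` \<Omega> = \<Omega>}"
  then have "act (inv g) ` \<Omega> = act (inv g) ` act g ` \<Omega>" by simp
  also have "\<dots> = (\<lambda>y. act (inv g) (act g y)) ` \<Omega>"
    by (rule image_image)
  also have "\<dots> = (\<lambda>y. y) ` \<Omega>"
    using g assms by (intro image_cong) auto
  also have "\<dots> = \<Omega>" by simp
  finally have "act (inv g) ` \<Omega> = \<Omega>" .
  then show "inv g \<in> {g \<in> carrier G. act g ` \<Omega> = \<Omega>}"
    using g by simp
next
  fix g h assume gh: "g \<in> {g \<in> carrier G. act g ` \<Omega> = \<Omega>}" "h \<in> {g \<in> carrier G. act g ` \<Omega> = \<Omega>}"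
  then have "act (g \<otimes> h) y = act h (act g y)" if "y \<in> \<Omega>" for y
    using act_mult assms that by blast
  then have "act (g \<otimes> h) ` \<Omega> = (\<lambda>y. act h (act g y)) ` \<Omega>"
    by (rule image_cong[OF refl])
  also have "\<dots> = act h ` act g ` \<Omega>"
    by (rule image_image[symmetric])
  also have "\<dots> = \<Omega>"
    using gh by simp
  finally have "act (g \<otimes> h) ` \<Omega> = \<Omega>" .
  then show "g \<otimes> h \<in> {g \<in> carrier G. act g ` \<Omega> = \<Omega>}"
    using gh by blast
qed auto

text \<open>The library orbit in image form, so that \<open>Orb\<close> becomes a family indexed by
  \<open>W\<close>.\<close>

definition orb where "orb H u = (\<lambda>g. act g u) ` H"

lemma orbI: "g \<in> H \<Longrightarrow> act g u \<in> orb H u"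
  by (simp add: orb_def)

lemma orbE:
  assumes "y \<in> orb H u" obtains g where "g \<in> H" "y = act g u"
  using assms by (auto simp: orb_def)

lemma Orb_eq: "Orb G A W H = orb H ` W"
  by (auto simp: Orb_def orbits_def orbit_def orb_def image_def)

lemma orb_subset: "subgroup H G \<Longrightarrow> u \<in> W \<Longrightarrow> orb H u \<subseteq> W"
  using subgroup.mem_carrier by (fastforce elim!: orbE)

lemma orb_self: "subgroup H G \<Longrightarrow> u \<in> W \<Longrightarrow> u \<in> orb H u"
  using orbI[of \<one> H u] by (simp add: subgroup.one_closed)

text \<open>Invariance under all of \<open>K\<close> upgrades inclusion to equality: a point
  \<open>y\<close> is the image under \<open>g\<close> of \<open>act (inv g) y\<close>, and
  \<open>inv g\<close> is in \<open>K\<close> too.\<close>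

lemma subset_setwise_stabilizer:
  assumes K: "subgroup K G" and "\<Omega> \<subseteq> W" "\<And>g y. g \<in> K \<Longrightarrow> y \<in> \<Omega> \<Longrightarrow> act g y \<in> \<Omega>" "g \<in> K"
  shows "act g ` \<Omega> = \<Omega>"
proof
  show "act g ` \<Omega> \<subseteq> \<Omega>" using assms by auto
  have "y \<in> act g ` \<Omega>" if "y \<in> \<Omega>" for y
    using that assms subgroup.mem_carrier[OF K \<open>g \<in> K\<close>] subgroup.m_inv_closed[OF K \<open>g \<in> K\<close>]
    by (intro image_eqI[of _ _ "act (inv g) y"]) auto
  then show "\<Omega> \<subseteq> act g ` \<Omega>" by auto
qed

lemma act_orb:
  assumes H: "subgroup H G" and u: "u \<in> W" and g: "g \<in> H"
  shows "act g ` orb H u = orb H u"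
proof (rule subset_setwise_stabilizer[OF H orb_subset[OF H u] _ g])
  fix g y assume "g \<in> H" "y \<in> orb H u"
  then show "act g y \<in> orb H u"
    using u H subgroup.mem_carrier[OF H] subgroup.m_closed[OF H]
    by (auto simp: act_mult[symmetric] elim!: orbE intro!: orbI)
qed

section \<open>The relative closure and the radical\<close>

text \<open>This is the group \<open>M\<close> of the overview; \<open>clos_closure\<close>
  identifies it as the relative closure.\<close>

definition clos :: "'a set \<Rightarrow> 'a set"
  where "clos H = {g \<in> carrier G. \<forall>\<Omega>\<in>Orb G A W H. act g ` \<Omega> = \<Omega>}"

lemma closD: "g \<in> clos H \<Longrightarrow> u \<in> W \<Longrightarrow> y \<in> orb H u \<Longrightarrow> act g y \<in> orb H u"
  unfolding clos_def Orb_eq by blast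

lemma clos_subgroup:
  assumes H: "subgroup H G" shows "subgroup (clos H) G"
proof -
  \<comment> \<open>As \<open>W\<close> is nonempty, there is at least one orbit, so the
    intersection stays inside \<open>carrier G\<close>.\<close>
  have "clos H = (\<Inter>\<Omega>\<in>Orb G A W H. {g \<in> carrier G. act g ` \<Omega> = \<Omega>})"
    using W.one_closed unfolding clos_def Orb_eq by blast
  also have "subgroup \<dots> G"
    by (intro subgroups_Inter)
      (use orb_subset[OF H] W_nonempty in \<open>auto simp: Orb_eq intro!: subgroup_setwise_stabilizer\<close>)
  finally show ?thesis .
qed

text \<open>Each element of \<open>L\<close> preserves the orbits of \<open>L\<close>, and these are
  the orbits of \<open>H\<close>.\<close>

lemma clos_ge:
  assumes "subgroup L G" "Orb G A W L = Orb G A W H" shows "L \<subseteq> clos H"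
  using act_orb[OF assms(1)] subgroup.mem_carrier[OF assms(1)]
  unfolding clos_def assms(2)[symmetric] by (auto simp: Orb_eq)

lemma orb_clos:
  assumes H: "subgroup H G" and u: "u \<in> W" shows "orb (clos H) u = orb H u"
proof
  show "orb H u \<subseteq> orb (clos H) u"
    using clos_ge[OF H] by (auto simp: orb_def)
  show "orb (clos H) u \<subseteq> orb H u"
    using closD[OF _ u orb_self[OF H u]] by (auto elim!: orbE)
qed

lemma clos_closure:
  assumes H: "subgroup H G" shows "is_relative_closure G A W H (clos H)"
  using clos_subgroup[OF H] orb_clos[OF H] clos_ge
  unfolding is_relative_closure_def by (auto simp: Orb_eq intro!: image_cong)

text \<open>Every \<open>rad_set\<close> lies in \<open>W\<close> and at least one orbit exists, so
  both sides collect the elements of \<open>W\<close> that preserve all orbits. The radical thus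
  inherits the subgroup property from \<open>clos H\<close> and \<open>W\<close>.\<close>

lemma rad_eq: "rad G A W H = clos H \<inter> W"
  using W.one_closed W.mem_carrier unfolding rad_def rad_set_def clos_def Orb_eq by blast

lemma rad_subset: "rad G A W H \<subseteq> W"
  by (simp add: rad_eq)

lemma rad_subgroup: "subgroup H G \<Longrightarrow> subgroup (rad G A W H) G"
  using clos_subgroup W_sub by (simp add: rad_eq subgroups_Inter_pair)

lemma rad_normal: "subgroup H G \<Longrightarrow> rad G A W H \<lhd> G"
  using normal_subset_cyclic_normal[OF W cyc_W rad_subgroup] by (simp add: rad_eq)

section \<open>The kernel of the action on the cosets of a normal subgroup\<close>

text \<open>For normal \<open>R\<close> inside \<open>W\<close>, this is the kernel of
  \<open>G\<close> on \<open>W/R\<close>. That two points share a coset is expressed by their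
  difference lying in \<open>R\<close>, here and below.\<close>

definition kern :: "'a set \<Rightarrow> 'a set"
  where "kern R = {g \<in> carrier G. \<forall>u\<in>W. inv u \<otimes> act g u \<in> R}"

lemma kernI:
  "g \<in> carrier G \<Longrightarrow> (\<And>u. u \<in> W \<Longrightarrow> inv u \<otimes> act g u \<in> R) \<Longrightarrow> g \<in> kern R"
  unfolding kern_def by blast

lemma kernD: "g \<in> kern R \<Longrightarrow> u \<in> W \<Longrightarrow> inv u \<otimes> act g u \<in> R"
  unfolding kern_def by blast

lemma kern_carrier: "g \<in> kern R \<Longrightarrow> g \<in> carrier G"
  unfolding kern_def by blast

context
  fixes R assumes R: "R \<lhd> G" and RW: "R \<subseteq> W"
begin

interpretation R: normal R G by (rule R)

lemma coset_trans:
  assumes "u \<in> W" "v \<in> W" "w \<in> W" "inv u \<otimes> v \<in> R" "inv v \<otimes> w \<in> R" shows "inv u \<otimes> w \<in> R"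
proof -
  have "inv u \<otimes> w = (inv u \<otimes> v) \<otimes> (inv v \<otimes> w)"
    using assms(1-3) by (simp add: m_assoc inv_mult_cancel)
  then show ?thesis using assms(4,5) by simp
qed

text \<open>By \<open>act_diff\<close> the new difference is a conjugate of the old one, and
  \<open>R\<close> is normal.\<close>

lemma coset_act:
  assumes "g \<in> carrier G" "u \<in> W" "y \<in> W" "inv u \<otimes> y \<in> R"
  shows "inv (act g u) \<otimes> act g y \<in> R"
  using assms by (simp add: act_diff R.inv_op_closed1)

lemma coset_stabilizer_subgroup:
  assumes u: "u \<in> W"
  shows "subgroup {g \<in> carrier G. inv u \<otimes> act g u \<in> R} G"
proof (rule subgroupI)
  show "{g \<in> carrier G. inv u \<otimes> act g u \<in> R} \<noteq> {}"
    using u by (auto intro!: exI[of _ \<one>])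
next
  fix g assume g: "g \<in> {g \<in> carrier G. inv u \<otimes> act g u \<in> R}"
  then have "inv (act (inv g) u) \<otimes> u \<in> R"
    using coset_act[of "inv g" u "act g u"] u by simp
  then have "inv (inv (act (inv g) u) \<otimes> u) \<in> R"
    by simp
  then show "inv g \<in> {g \<in> carrier G. inv u \<otimes> act g u \<in> R}"
    using u g by (simp add: inv_mult_group)
next
  fix g h assume "g \<in> {g \<in> carrier G. inv u \<otimes> act g u \<in> R}"
    "h \<in> {g \<in> carrier G. inv u \<otimes> act g u \<in> R}"
  then show "g \<otimes> h \<in> {g \<in> carrier G. inv u \<otimes> act g u \<in> R}"
    using u coset_act[of h u "act g u"] coset_trans[of u "act h u"] by (simp add: act_mult)
qed auto

lemma kern_normal: "kern R \<lhd> G"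
proof (rule normal_invI)
  have "kern R = (\<Inter>u\<in>W. {g \<in> carrier G. inv u \<otimes> act g u \<in> R})"
    using W.one_closed unfolding kern_def by blast
  also have "subgroup \<dots> G"
    by (intro subgroups_Inter)
      (use W_nonempty in \<open>auto intro!: coset_stabilizer_subgroup\<close>)
  finally show "subgroup (kern R) G" .
next
  fix x h assume x: "x \<in> carrier G" and h: "h \<in> kern R"
  have hc: "h \<in> carrier G" using kern_carrier[OF h] .
  \<comment> \<open>\<open>h\<close> fixes the coset of \<open>act x u\<close>, and
    \<open>inv x\<close> carries this coset back to that of \<open>u\<close>.\<close>
  have "inv u \<otimes> act (x \<otimes> h \<otimes> inv x) u \<in> R" if u: "u \<in> W" for u
    using coset_act[of "inv x" "act x u" "act h (act x u)"] kernD[OF h, of "act x u"] x hc u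
    by (simp add: act_mult)
  then show "x \<otimes> h \<otimes> inv x \<in> kern R"
    using x hc by (intro kernI) auto
qed

lemma cent_quot_subset_kern: "cent_quot G A W R \<subseteq> kern R"
proof
  fix b assume b: "b \<in> cent_quot G A W R"
  then have bA: "b \<in> A" by (simp add: cent_quot_def)
  have "inv u \<otimes> act b u \<in> R" if u: "u \<in> W" for u
  proof -
    have "R #> u \<in> carrier (G\<lparr>carrier := W\<rparr> Mod R)"
      using u by (auto simp: FactGroup_def RCOSETS_def r_coset_def)
    then have "conj_by G b ` (R #> u) = R #> u"
      using b by (simp add: cent_quot_def)
    moreover have "u \<in> R #> u"
      using u rcos_self[OF _ R.subgroup_axioms] by auto
    ultimately have "act b u \<in> R #> u"
      using act_A[OF bA u] by auto
    then obtain r where r: "r \<in> R" "act b u = r \<otimes> u"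
      by (auto simp: r_coset_def)
    \<comment> \<open>The quotient consists of right cosets, whereas \<open>kern\<close> measures
      differences on the left; commutativity of \<open>W\<close> reconciles them.\<close>
    then have "act b u = u \<otimes> r"
      using W_comm u RW by auto
    then show ?thesis
      using u r by (simp add: m_assoc[symmetric])
  qed
  then show "b \<in> kern R"
    using bA by (intro kernI) auto
qed

lemma subset_kern: "R \<subseteq> kern R"
proof
  fix r assume r: "r \<in> R"
  have "inv u \<otimes> act r u \<in> R" if "u \<in> W" for u
    using that r RW by (simp add: act_W subset_iff m_assoc[symmetric])
  then show "r \<in> kern R"
    using r by (intro kernI) auto
qed

lemma kern_A_subset_cent_quot: "kern R \<inter> A \<subseteq> cent_quot G A W R"
proof
  fix b assume b: "b \<in> kern R \<inter> A"
  interpret K: normal "kern R" G by (rule kern_normal)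
  have "conj_by G b ` C = C" if C: "C \<in> carrier (G\<lparr>carrier := W\<rparr> Mod R)" for C
  proof -
    obtain u where u: "u \<in> W" "C = R #> u"
      using C by (auto simp: FactGroup_def RCOSETS_def r_coset_def)
    have CW: "C \<subseteq> W"
      using u RW by (auto simp: r_coset_def)
    \<comment> \<open>The whole group \<open>kern R\<close> maps \<open>C\<close> into itself, so
      \<open>b\<close> maps it onto itself; on \<open>A\<close> the action is conjugation.\<close>
    have "act b ` C = C"
    proof (rule subset_setwise_stabilizer[OF K.subgroup_axioms CW])
      fix g y assume g: "g \<in> kern R" and y: "y \<in> C"
      have yW: "y \<in> W" using y CW by auto
      have gW: "act g y \<in> W" using kern_carrier[OF g] yW by (rule act_closed)
      have d: "inv y \<otimes> act g y \<in> R" using kernD[OF g yW] .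
      obtain r where r: "r \<in> R" "y = r \<otimes> u" using y u by (auto simp: r_coset_def)
      have "act g y = y \<otimes> (inv y \<otimes> act g y)"
        using yW gW by (simp add: m_assoc[symmetric])
      also have "\<dots> = (inv y \<otimes> act g y) \<otimes> y"
        using yW gW by (intro W_comm) auto
      also have "\<dots> = ((inv y \<otimes> act g y) \<otimes> r) \<otimes> u"
        using m_assoc[OF R.mem_carrier[OF d] R.mem_carrier[OF r(1)] W.mem_carrier[OF u(1)]] r(2)
        by simp
      finally show "act g y \<in> C"
        using d r u by (auto simp: r_coset_def)
    next
      show "b \<in> kern R" using b by simp
    qed
    moreover have "act b ` C = conj_by G b ` C"
      using b CW by (intro image_cong) (auto simp: act_A)
    ultimately show ?thesis by simp
  qed
  with b show "b \<in> cent_quot G A W R"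
    by (simp add: cent_quot_def)
qed

lemma kern_eq: "kern R = R <#> cent_quot G A W R"
proof
  interpret K: normal "kern R" G by (rule kern_normal)
  show "R <#> cent_quot G A W R \<subseteq> kern R"
    using subset_kern cent_quot_subset_kern by (auto simp: set_mult_def)
  show "kern R \<subseteq> R <#> cent_quot G A W R"
  proof
    fix g assume g: "g \<in> kern R"
    then obtain b v where bv: "b \<in> A" "v \<in> W" "g = b \<otimes> v"
      using split K.mem_carrier by metis
    have bc: "b \<in> carrier G" and vc: "v \<in> carrier G" using bv by auto
    \<comment> \<open>Evaluating at the identity isolates the \<open>W\<close>-component, because
      \<open>b\<close> fixes it: \<open>act g \<one> = v\<close>.\<close>
    have "inv \<one> \<otimes> act g \<one> \<in> R"
      using kernD[OF g W.one_closed] .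
    then have v: "v \<in> R"
      using bc vc bv by (simp add: act_split)
    have "b = g \<otimes> inv v"
      using bc vc bv by (simp add: m_assoc)
    then have "b \<in> kern R"
      using g v subset_kern by auto
    then have b: "b \<in> cent_quot G A W R"
      using kern_A_subset_cent_quot bv by auto
    \<comment> \<open>Normality of \<open>R\<close> lets the factor from \<open>R\<close> move to
      the front.\<close>
    have "g = (b \<otimes> v \<otimes> inv b) \<otimes> b"
      using bc vc bv by (simp add: m_assoc)
    moreover have "b \<otimes> v \<otimes> inv b \<in> R"
      using R.inv_op_closed2 bc v by blast
    ultimately show "g \<in> R <#> cent_quot G A W R"
      using b by (auto simp: set_mult_def)
  qed
qed

end

section \<open>The product formula for the relative closure\<close>

text \<open>The image of \<open>M\<close> in \<open>G/W\<close>, which is isomorphic to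
  \<open>A\<close>, is cyclic. With \<open>a\<close> generating \<open>A\<close>, the exponents
  \<open>k\<close> for which \<open>W #> (a [^] k)\<close> meets \<open>M\<close> form a subgroup of
  the integers with some generator \<open>d\<close>; any element of \<open>M\<close> over
  \<open>a [^] d\<close> serves as \<open>g\<close>.\<close>

lemma generator_mod_W:
  assumes M: "subgroup M G"
  obtains g where "g \<in> M" "\<And>x. x \<in> M \<Longrightarrow> \<exists>k::int. inv (g [^] k) \<otimes> x \<in> W"
proof -
  interpret M: subgroup M G by (rule M)
  interpret GA: group "G\<lparr>carrier := A\<rparr>"
    using A subgroup_imp_group by blast
  obtain a where a: "a \<in> A" "A = range (\<lambda>n::int. a [^] n)"
    using cyc_A unfolding GA.cyclic_group
    by (auto simp: int_pow_consistent[OF A, symmetric])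
  have ac: "a \<in> carrier G" using a by auto
  interpret Q: group "G Mod W"
    by (rule W.factorgroup_is_group)
  have hom: "W #> (x \<otimes> y) = (W #> x) \<otimes>\<^bsub>G Mod W\<^esub> (W #> y)"
    if "x \<in> carrier G" "y \<in> carrier G" for x y
    using that by (simp add: FactGroup_def W.rcos_sum)
  define I where "I = {k::int. \<exists>x\<in>M. W #> x = W #> (a [^] k)}"
  have I_E: thesis if "k \<in> I" "\<And>x. x \<in> M \<Longrightarrow> W #> x = W #> (a [^] k) \<Longrightarrow> thesis" for k thesis
    using that unfolding I_def by blast
  have "0 \<in> I"
    by (auto simp: I_def intro!: bexI[of _ \<one>])
  moreover have "i - j \<in> I" if i: "i \<in> I" and j: "j \<in> I" for i j
  proof -
    obtain x where x: "x \<in> M" "W #> x = W #> (a [^] i)"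
      using I_E[OF i] by blast
    obtain y where y: "y \<in> M" "W #> y = W #> (a [^] j)"
      using I_E[OF j] by blast
    note xy = x y
    have "W #> inv y = W #> inv (a [^] j)"
      using xy W.rcos_inv[of y] W.rcos_inv[of "a [^] j"] ac by simp
    then have "W #> (x \<otimes> inv y) = W #> (a [^] i \<otimes> inv (a [^] j))"
      using xy ac by (simp add: hom)
    then show ?thesis
      using xy ac unfolding I_def by (auto simp: int_pow_diff intro!: bexI[of _ "x \<otimes> inv y"])
  qed
  ultimately obtain d where d: "d \<in> I" "\<And>i. i \<in> I \<Longrightarrow> d dvd i"
    using int_subgroup_principal by metis
  obtain g where g: "g \<in> M" "W #> g = W #> (a [^] d)"
    using I_E[OF d(1)] by blast
  have "\<exists>k::int. inv (g [^] k) \<otimes> x \<in> W" if x: "x \<in> M" for x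
  proof -
    have xc: "x \<in> carrier G" using x by simp
    obtain b v where bv: "b \<in> A" "v \<in> W" "x = b \<otimes> v"
      using split[OF xc] .
    obtain e :: int where e: "b = a [^] e"
      using a bv by blast
    have "x \<otimes> inv b \<in> W"
      using bv by (simp add: W.inv_op_closed2)
    then have Wx: "W #> x = W #> b"
      using bv by (metis A.mem_carrier W.mem_carrier W.rcos_module[OF is_group] W_sub m_closed repr_independence rcos_self)
    then have "e \<in> I"
      using x e by (auto simp: I_def)
    then obtain k where k: "e = d * k"
      using d(2) by blast
    have gc: "g \<in> carrier G" using g by simp
    have "W #> (g [^] k) = (W #> g) [^]\<^bsub>G Mod W\<^esub> k"
      using gc by (simp add: W.FactGroup_int_pow)
    also have "\<dots> = W #> ((a [^] d) [^] k)"
      using g ac by (simp add: W.FactGroup_int_pow)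
    finally have "W #> (g [^] k) = W #> x"
      using Wx e k ac by (simp add: int_pow_pow)
    then have "(g [^] k) <# W = x <# W"
      using W.coset_eq gc xc by simp
    then have "inv (g [^] k) \<otimes> x \<in> W"
      using gc xc W_sub by (metis int_pow_closed lcos_self W.lcos_module_imp is_group l_coset_def)
    then show ?thesis by blast
  qed
  with g that show ?thesis by blast
qed

lemma clos_eq:
  assumes H: "subgroup H G"
  shows "clos H = H <#> kern (rad G A W H)"
proof -
  define R where "R = rad G A W H"
  define M where "M = clos H"
  have Rn: "R \<lhd> G" using rad_normal[OF H] by (simp add: R_def)
  have RM: "R = M \<inter> W" by (simp add: R_def M_def rad_eq)
  then have RW: "R \<subseteq> W" by simp
  interpret H: subgroup H G by (rule H)
  interpret M: subgroup M G unfolding M_def by (rule clos_subgroup[OF H])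
  interpret N: normal "kern R" G by (rule kern_normal[OF Rn RW])
  have HM: "H \<subseteq> M" unfolding M_def by (rule clos_ge[OF H refl])
  have T: "subgroup (H <#> kern R) G"
    using commut_normal[OF H N.normal_axioms] mult_norm_subgroup[OF N.normal_axioms H] by simp
  have NM: "kern R \<subseteq> M"
  proof
    fix g assume g: "g \<in> kern R"
    have "act g ` orb H u = orb H u" if u: "u \<in> W" for u
    proof (rule subset_setwise_stabilizer[OF N.subgroup_axioms orb_subset[OF H u] _ g])
      fix n y assume n: "n \<in> kern R" and y: "y \<in> orb H u"
      have yW: "y \<in> W" using y orb_subset[OF H u] by auto
      have nW: "act n y \<in> W" using kern_carrier[OF n] yW by (rule act_closed)
      have r: "inv y \<otimes> act n y \<in> R" using kernD[OF n yW] .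
      \<comment> \<open>At the point \<open>y\<close>, the element \<open>n\<close> acts like a
        translation by an element of \<open>R\<close>, and \<open>R\<close> preserves every orbit of
        \<open>H\<close>. The translation may vary with \<open>y\<close>.\<close>
      have "act n y = act (inv y \<otimes> act n y) y"
        by (simp only: act_W[OF subsetD[OF RW r] yW]
            inv_mult_cancel(2)[OF W.mem_carrier[OF yW] W.mem_carrier[OF nW]])
      also have "\<dots> \<in> orb H u"
        using r RM closD[OF _ u y] by (simp add: M_def)
      finally show "act n y \<in> orb H u" .
    qed
    then show "g \<in> M"
      using kern_carrier[OF g] unfolding M_def clos_def Orb_eq by blast
  qed
  obtain g where g: "g \<in> M" and gen: "\<And>x. x \<in> M \<Longrightarrow> \<exists>k::int. inv (g [^] k) \<otimes> x \<in> W"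
    using generator_mod_W[OF M.subgroup_axioms] by blast
  have gc: "g \<in> carrier G" using g by simp
  \<comment> \<open>The quotient lies in \<open>M\<close> as well as in \<open>W\<close>, hence in
    \<open>R\<close>.\<close>
  have gen': "\<exists>k::int. inv (g [^] k) \<otimes> x \<in> R" if x: "x \<in> M" for x
    using gen[OF x] x g subgroup_int_pow_closed[OF M.subgroup_axioms g] RM by auto
  have RN: "R \<subseteq> kern R" by (rule subset_kern[OF Rn RW])
  have NT: "kern R \<subseteq> H <#> kern R"
    unfolding set_mult_def by (force intro: H.one_closed)
  have HT: "H \<subseteq> H <#> kern R"
    unfolding set_mult_def by (force intro: N.one_closed)
  have "g \<in> H <#> kern R"
  proof (rule mem_subgroup_of_power_conditions[OF T gc fin,
        where St = "\<lambda>u. {g \<in> carrier G. inv u \<otimes> act g u \<in> R}"])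
    fix x assume "x \<in> carrier G" "\<And>u. u \<in> W \<Longrightarrow> x \<in> {g \<in> carrier G. inv u \<otimes> act g u \<in> R}"
    then show "x \<in> H <#> kern R"
      using NT kernI[of x R] by blast
  next
    fix u assume u: "u \<in> W"
    show "subgroup {g \<in> carrier G. inv u \<otimes> act g u \<in> R} G"
      by (rule coset_stabilizer_subgroup[OF Rn RW u])
    \<comment> \<open>Here the equality of orbits enters: \<open>g\<close> agrees at the single
      point \<open>u\<close> with some \<open>h\<close> in \<open>H\<close>, and modulo
      \<open>R\<close> this \<open>h\<close> is the power \<open>g [^] j\<close> sought.\<close>
    have "act g u \<in> orb H u"
      using g orb_clos[OF H u] orbI[of g M u] by (simp add: M_def)
    then obtain h where h: "h \<in> H" "act g u = act h u" by (rule orbE)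
    have hc: "h \<in> carrier G" using h by simp
    obtain j :: int where j: "inv (g [^] j) \<otimes> h \<in> R"
      using gen'[of h] h HM by auto
    define m where "m = inv (g [^] j) \<otimes> h"
    have m: "m \<in> kern R" "m \<in> carrier G"
      using j RN by (auto simp: m_def)
    have gj: "g [^] j = h \<otimes> inv m"
      using gc hc by (simp add: m_def inv_mult_group m_assoc[symmetric])
    have "g [^] j \<in> H <#> kern R"
      unfolding gj using h m by (auto simp: set_mult_def)
    moreover have "inv u \<otimes> act (g [^] (1 - j)) u \<in> R"
    proof -
      \<comment> \<open>Acting on \<open>u\<close>: \<open>g\<close> leads to
        \<open>act h u\<close>, \<open>m\<close> keeps its coset, and \<open>inv h\<close> returns
        to the coset of \<open>u\<close>.\<close>
      have "g [^] (1 - j) = g \<otimes> (m \<otimes> inv h)"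
        using gc hc m by (simp add: int_pow_diff gj inv_mult_group)
      then have "act (g [^] (1 - j)) u = act (inv h) (act m (act g u))"
        using gc hc m u by (simp add: act_mult)
      moreover have "inv (act g u) \<otimes> act m (act g u) \<in> R"
        using kernD[OF m(1)] u gc by simp
      then have "inv (act (inv h) (act g u)) \<otimes> act (inv h) (act m (act g u)) \<in> R"
        using m u gc hc by (intro coset_act[OF Rn RW]) auto
      ultimately show ?thesis
        using h hc u by simp
    qed
    ultimately show "\<exists>j::int. g [^] j \<in> H <#> kern R \<and>
        g [^] (1 - j) \<in> {g \<in> carrier G. inv u \<otimes> act g u \<in> R}"
      using gc by blast
  qed
  then have gT: "g [^] k \<in> H <#> kern R" for k :: int
    by (rule subgroup_int_pow_closed[OF T])
  have "M \<subseteq> H <#> kern R"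
  proof
    fix x assume x: "x \<in> M"
    then obtain k :: int where k: "inv (g [^] k) \<otimes> x \<in> R"
      using gen' by blast
    have "g [^] k \<otimes> (inv (g [^] k) \<otimes> x) \<in> H <#> kern R"
      using subgroup.m_closed[OF T gT] k RN NT by blast
    then show "x \<in> H <#> kern R"
      using x gc by (simp add: m_assoc[symmetric])
  qed
  moreover have "H <#> kern R \<subseteq> M"
    using HM NM by (auto simp: set_mult_def)
  ultimately show ?thesis
    by (simp add: M_def R_def)
qed

lemma relative_closure_unique:
  "is_relative_closure G A W H K \<Longrightarrow> is_relative_closure G A W H L \<Longrightarrow> K = L"
  unfolding is_relative_closure_def by blast

lemma clos_eq_product:
  assumes H: "subgroup H G"
  shows "clos H = H <#> rad G A W H <#> cent_quot G A W (rad G A W H)"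
proof -
  have "cent_quot G A W (rad G A W H) \<subseteq> carrier G"
    by (auto simp: cent_quot_def)
  then have "H <#> rad G A W H <#> cent_quot G A W (rad G A W H) =
      H <#> (rad G A W H <#> cent_quot G A W (rad G A W H))"
    by (intro set_mult_assoc subgroup.subset[OF H] subgroup.subset[OF rad_subgroup[OF H]])
  also have "\<dots> = clos H"
    using clos_eq[OF H] kern_eq[OF rad_normal[OF H] rad_subset] by simp
  finally show ?thesis ..
qed

text \<open>Being closed means \<open>clos H = H\<close>. Then \<open>rad_eq\<close> gives the first
  condition, and the factor \<open>kern\<close> of the product formula gives the second. Conversely,
  the two conditions place all three factors of \<open>clos_eq_product\<close> in
  \<open>H\<close>.\<close>

lemma relatively_closed_iff:
  assumes H: "subgroup H G"
  shows "relatively_closed G A W H \<longleftrightarrow>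
    rad G A W H = H \<inter> W \<and> cent_quot G A W (H \<inter> W) \<subseteq> H"
proof -
  have "relatively_closed G A W H \<longleftrightarrow> clos H = H"
    unfolding relatively_closed_def using clos_closure[OF H] relative_closure_unique by metis
  also have "\<dots> \<longleftrightarrow> rad G A W H = H \<inter> W \<and> cent_quot G A W (H \<inter> W) \<subseteq> H"
  proof
    assume eq: "clos H = H"
    have "kern (rad G A W H) \<subseteq> H <#> kern (rad G A W H)"
      unfolding set_mult_def using subgroup.one_closed[OF H] kern_carrier by force
    also have "\<dots> = H"
      using clos_eq[OF H] eq by simp
    finally show "rad G A W H = H \<inter> W \<and> cent_quot G A W (H \<inter> W) \<subseteq> H"
      using cent_quot_subset_kern[OF rad_normal[OF H] rad_subset] eq rad_eq[of H] by auto
  next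
    assume a: "rad G A W H = H \<inter> W \<and> cent_quot G A W (H \<inter> W) \<subseteq> H"
    then have "clos H \<subseteq> H"
      using clos_eq_product[OF H] subgroup.m_closed[OF H] by (auto simp: set_mult_def)
    then show "clos H = H"
      using clos_ge[OF H refl] by auto
  qed
  finally show ?thesis .
qed

end

section \<open>From the given permutation group to the split extension\<close>

theorem theorem1:
  fixes G :: "('g, 'm) monoid_scheme"
    and S :: "'x set"
    and \<phi> :: "'g \<Rightarrow> 'x \<Rightarrow> 'x"
    and W A H :: "'g set"
    and x :: 'x
  assumes "faithful_action G S \<phi>"
    and "finite (carrier G)"
    and "W \<lhd> G"
    and "regular_on G S \<phi> W"
    and "cyclic_group (G\<lparr>carrier := W\<rparr>)"
    and "x \<in> S"
    and "A = stabilizer G \<phi> x"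
    and "cyclic_group (G\<lparr>carrier := A\<rparr>)"
    and "subgroup H G"
  shows "(relatively_closed G A W H \<longleftrightarrow>
            rad G A W H = H \<inter> W \<and> cent_quot G A W (H \<inter> W) \<subseteq> H)
       \<and> is_relative_closure G A W H
            (H <#>\<^bsub>G\<^esub> rad G A W H <#>\<^bsub>G\<^esub> cent_quot G A W (rad G A W H))"
proof -
  interpret faithful_action G S \<phi> by fact
  interpret group G
    using group_hom group_hom.axioms(1) by blast
  interpret W: normal W G by fact
  interpret T: transitive_action "G\<lparr>carrier := W\<rparr>" S \<phi>
    using assms(4) by (simp add: regular_on_def)
  have A: "subgroup A G"
    using assms(6,7) stabilizer_subgroup by simp
  have "A \<inter> W = {\<one>\<^bsub>G\<^esub>}"
    using assms(4,6) W.subset by (auto simp: assms(7) regular_on_def stabilizer_def)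
  moreover have "carrier G \<subseteq> A <#>\<^bsub>G\<^esub> W"
  proof
    \<comment> \<open>Transitivity of \<open>W\<close> supplies \<open>v\<close> agreeing with
      \<open>g\<close> at \<open>x\<close>; then \<open>b\<close> fixes \<open>x\<close>, and
      conjugating \<open>v\<close> by \<open>b\<close> turns \<open>g = v b\<close> into a product
      with the \<open>A\<close>-factor first.\<close>
    fix g assume g: "g \<in> carrier G"
    obtain v where v: "v \<in> W" "\<phi> v x = \<phi> g x"
      using T.unique_orbit[of x "\<phi> g x"] assms(6) element_image[OF g assms(6)] by auto
    have vc: "v \<in> carrier G" using v by simp
    define b where "b = inv\<^bsub>G\<^esub> v \<otimes>\<^bsub>G\<^esub> g"
    have bc: "b \<in> carrier G" using g vc by (simp add: b_def)
    have "\<phi> b x = \<phi> (inv\<^bsub>G\<^esub> v) (\<phi> v x)"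
      using g vc assms(6) v by (simp add: b_def composition_rule)
    also have "\<dots> = x"
      using vc assms(6) orbit_sym_aux by blast
    finally have "b \<in> A" using bc by (simp add: assms(7) stabilizer_def)
    moreover have "g = b \<otimes>\<^bsub>G\<^esub> (inv\<^bsub>G\<^esub> b \<otimes>\<^bsub>G\<^esub> v \<otimes>\<^bsub>G\<^esub> b)"
      using g vc bc by (simp add: m_assoc inv_mult_cancel) (simp add: b_def inv_mult_cancel)
    moreover have "inv\<^bsub>G\<^esub> b \<otimes>\<^bsub>G\<^esub> v \<otimes>\<^bsub>G\<^esub> b \<in> W"
      using v bc W.inv_op_closed1 by blast
    ultimately show "g \<in> A <#>\<^bsub>G\<^esub> W"
      unfolding set_mult_def by blast
  qed
  then have "A <#>\<^bsub>G\<^esub> W = carrier G"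
    using setmult_subset_G[OF subgroup.subset[OF A] W.subset] by (rule subset_antisym[rotated])
  moreover have "finite W"
    using assms(2) W.subset finite_subset by blast
  ultimately interpret cyclic_split_extension G A W
    using A assms(3,5,8)
    by (intro cyclic_split_extension.intro cyclic_split_extension_axioms.intro is_group)
  show ?thesis
    using relatively_closed_iff clos_closure clos_eq_product assms(9) by simp
qed

end
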